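(* Let $T$ be a complete (continuous or discrete) theory with monster model $\mathbb{M}$, and suppose $\mathop{\smile\!\!\!\!\!\mid}$ is a stationary independence relation on small subsets of $\mathbb{M}$. Then for all small $A,B,C\subset\mathbb{M}$, $A\mathop{\smile\!\!\!\!\!\mid}_C B$ implies both $A\mathop{\smile\!\!\!\!\!\mid}^f_C B$ and $B\mathop{\smile\!\!\!\!\!\mid}^f_C A$.
   Context: A ternary relation $A\mathop{\smile\!\!\!\!\!\mid}_C B$ on small subsets of $\mathbb{M}$ is a stationary independence relation if it satisfies: invariance (if $ABC$ and $A'B'C'$ have the same type, then $A\mathop{\smile\!\!\!\!\!\mid}_C B$ iff $A'\mathop{\smile\!\!\!\!\!\mid}_{C'}B'$); monotonicity ($A\mathop{\smile\!\!\!\!\!\mid}_C BD$ implies $A\mathop{\smile\!\!\!\!\!\mid}_C B$ and $A\mathop{\smile\!\!\!\!\!\mid}_{BC} D$); transitivity ($A\mathop{\smile\!\!\!\!\!\mid}_C B$ and $A\mathop{\smile\!\!\!\!\!\mid}_{BC} D$ imply $A\mathop{\smile\!\!\!\!\!\mid}_C BD$); symmetry ($A\mathop{\smile\!\!\!\!\!\mid}_C B$ iff $B\mathop{\smile\!\!\!\!\!\mid}_C A$); full existence (for all $A,B,C$ there is $A'\equiv_C A$ with $A'\mathop{\smile\!\!\!\!\!\mid}_C B$); stationarity (if $A\equiv_C A'$, $A\mathop{\smile\!\!\!\!\!\mid}_C B$ and $A'\mathop{\smile\!\!\!\!\!\mid}_C B$, then $A\equiv_{BC}A'$). Forking: a formula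 $\varphi(\bar x,\bar b)$ divides over $C$ if there are $(\bar b^l)_{l<\omega}$ with $\bar b^l\equiv_C\bar b$, $\epsilon>0$, $k>0$ with every $k$-element subset of $\{\varphi(\bar x,\bar b^l)\le\epsilon\}$ unsatisfiable (in discrete logic: $\{\varphi(\bar x,\bar b^l)\}$ is $k$-inconsistent); it forks over $C$ if it implies a finite disjunction (in continuous logic: $\varphi=0$ implies $\min_i\psi_i=0$) of formulas dividing over $C$; $A\mathop{\smile\!\!\!\!\!\mid}^f_C B$ means $\operatorname{tp}(A/BC)$ implies no formula forking over $C$. *)

theory Defs
  imports "HOL-Analysis.Analysis"
begin

unbundle cardinal_syntax

section \<open>Languages, terms and structures\<close>

record ('f, 'r) lang =
  funs :: "'f set"
  rels :: "'r set"
  fun_arity :: "'f \<Rightarrow> nat"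
  rel_arity :: "'r \<Rightarrow> nat"

text \<open>
  A structure interprets relation symbols with values in \<open>'v\<close>, which is \<open>bool\<close> in discrete logic and
  \<open>real\<close> in continuous logic. Only the interpretations of symbols of the language, on tuples of the
  correct length from the universe, are meaningful.
\<close>

record ('f, 'r, 'm, 'v) struct =
  universe :: "'m set"
  fun_of :: "'f \<Rightarrow> 'm list \<Rightarrow> 'm"
  rel_of :: "'r \<Rightarrow> 'm list \<Rightarrow> 'v"

definition tuples :: "'m set \<Rightarrow> nat \<Rightarrow> 'm list set" where
  "tuples U n = {xs. length xs = n \<and> set xs \<subseteq> U}"

definition closed_structure :: "('f, 'r, 'x) lang_scheme \<Rightarrow> ('f, 'r, 'm, 'v, 'y) struct_scheme \<Rightarrow> bool" where
  "closed_structure L M \<longleftrightarrow> universe M \<noteq> {} \<and>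
     (\<forall>f \<in> funs L. \<forall>xs \<in> tuples (universe M) (fun_arity L f). fun_of M f xs \<in> universe M)"

datatype 'f tm = Var nat | App 'f "'f tm list"

primrec tm_vars :: "'f tm \<Rightarrow> nat set" where
  "tm_vars (Var v) = {v}"
| "tm_vars (App f ts) = \<Union> (set (map tm_vars ts))"

primrec wf_tm :: "('f, 'r, 'x) lang_scheme \<Rightarrow> 'f tm \<Rightarrow> bool" where
  "wf_tm L (Var v) \<longleftrightarrow> True"
| "wf_tm L (App f ts) \<longleftrightarrow> f \<in> funs L \<and> length ts = fun_arity L f \<and> list_all id (map (wf_tm L) ts)"

primrec tm_val :: "('f, 'r, 'm, 'v, 'y) struct_scheme \<Rightarrow> (nat \<Rightarrow> 'm) \<Rightarrow> 'f tm \<Rightarrow> 'm" where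
  "tm_val M s (Var v) = s v"
| "tm_val M s (App f ts) = fun_of M f (map (tm_val M s) ts)"

definition automorphism ::
    "('f, 'r, 'x) lang_scheme \<Rightarrow> ('f, 'r, 'm, 'v, 'y) struct_scheme \<Rightarrow> ('m \<Rightarrow> 'm) \<Rightarrow> bool" where
  "automorphism L M g \<longleftrightarrow> bij_betw g (universe M) (universe M) \<and>
     (\<forall>f \<in> funs L. \<forall>xs \<in> tuples (universe M) (fun_arity L f).
        g (fun_of M f xs) = fun_of M f (map g xs)) \<and>
     (\<forall>r \<in> rels L. \<forall>xs \<in> tuples (universe M) (rel_arity L r).
        rel_of M r (map g xs) = rel_of M r xs)"

section \<open>Notions common to discrete and continuous logic\<close>

text \<open>
  The data about a structure that types depend on: the formulas of the language, their free
  variables, and their truth values under assignments. A formula holds when its truth value is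
  \<open>designated\<close> (\<open>True\<close> in discrete logic, \<open>0\<close> in continuous logic).
\<close>

record ('p, 'm, 'v) semantics =
  points :: "'m set"
  formulas :: "'p set"
  free_vars :: "'p \<Rightarrow> nat set"
  truth :: "'p \<Rightarrow> (nat \<Rightarrow> 'm) \<Rightarrow> 'v"
  designated :: 'v

text \<open>
  \<open>same_type S C I a a'\<close> is \<open>a \<equiv>\<^sub>C a'\<close> for the tuples \<open>(a i)\<close> and \<open>(a' i)\<close>, \<open>i \<in> I\<close>: each free variable of a
  formula is assigned either an entry of the tuple (\<open>Inl i\<close>) or a parameter from \<open>C\<close> (\<open>Inr c\<close>).
  A set \<open>A\<close> is enumerated by itself, so \<open>same_type S C A id f\<close> says \<open>A \<equiv>\<^sub>C f ` A\<close> via the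
  enumeration of \<open>f ` A\<close> that corresponds to \<open>A\<close> under \<open>f\<close>.
\<close>

definition same_type ::
    "('p, 'm, 'v) semantics \<Rightarrow> 'm set \<Rightarrow> 'i set \<Rightarrow> ('i \<Rightarrow> 'm) \<Rightarrow> ('i \<Rightarrow> 'm) \<Rightarrow> bool" where
  "same_type S C I a a' \<longleftrightarrow> a ` I \<subseteq> points S \<and> a' ` I \<subseteq> points S \<and>
     (\<forall>\<phi> \<in> formulas S. \<forall>s :: nat \<Rightarrow> 'i + 'm. s ` free_vars S \<phi> \<subseteq> I <+> C \<longrightarrow>
        truth S \<phi> (case_sum a id \<circ> s) = truth S \<phi> (case_sum a' id \<circ> s))"

text \<open>
  A formula with parameters \<open>\<phi>(x,b)\<close> is given by \<open>\<phi>\<close>, a set \<open>X\<close> of variables \<open>x\<close>, and an assignment \<open>b\<close>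
  of the remaining free variables \<open>params S X \<phi>\<close>; values of \<open>b\<close> elsewhere are irrelevant.
\<close>

definition params :: "('p, 'm, 'v) semantics \<Rightarrow> nat set \<Rightarrow> 'p \<Rightarrow> nat set" where
  "params S X \<phi> = free_vars S \<phi> - X"

definition instance_val ::
    "('p, 'm, 'v) semantics \<Rightarrow> nat set \<Rightarrow> 'p \<Rightarrow> (nat \<Rightarrow> 'm) \<Rightarrow> (nat \<Rightarrow> 'm) \<Rightarrow> 'v" where
  "instance_val S X \<phi> a b = truth S \<phi> (override_on b a X)"

definition instance_holds ::
    "('p, 'm, 'v) semantics \<Rightarrow> nat set \<Rightarrow> 'p \<Rightarrow> (nat \<Rightarrow> 'm) \<Rightarrow> (nat \<Rightarrow> 'm) \<Rightarrow> bool" where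
  "instance_holds S X \<phi> a b \<longleftrightarrow> instance_val S X \<phi> a b = designated S"

definition small :: "('p, 'm, 'v) semantics \<Rightarrow> 'k rel \<Rightarrow> 'm set \<Rightarrow> bool" where
  "small S \<kappa> A \<longleftrightarrow> A \<subseteq> points S \<and> |A| <o \<kappa>"

definition saturated :: "('p, 'm, 'v) semantics \<Rightarrow> 'k rel \<Rightarrow> bool" where
  "saturated S \<kappa> \<longleftrightarrow>
     (\<forall>C X \<Gamma>. small S \<kappa> C \<and> finite X \<and>
        (\<forall>(\<phi>, b) \<in> \<Gamma>. \<phi> \<in> formulas S \<and> b ` params S X \<phi> \<subseteq> C) \<and>
        (\<forall>\<Gamma>\<^sub>0. finite \<Gamma>\<^sub>0 \<and> \<Gamma>\<^sub>0 \<subseteq> \<Gamma> \<longrightarrow>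
           (\<exists>a. a ` X \<subseteq> points S \<and> (\<forall>(\<phi>, b) \<in> \<Gamma>\<^sub>0. instance_holds S X \<phi> a b))) \<longrightarrow>
        (\<exists>a. a ` X \<subseteq> points S \<and> (\<forall>(\<phi>, b) \<in> \<Gamma>. instance_holds S X \<phi> a b)))"

definition strongly_homogeneous ::
    "('p, 'm, 'v) semantics \<Rightarrow> (('m \<Rightarrow> 'm) \<Rightarrow> bool) \<Rightarrow> 'k rel \<Rightarrow> bool" where
  "strongly_homogeneous S aut \<kappa> \<longleftrightarrow>
     (\<forall>A f. small S \<kappa> A \<and> same_type S {} A id f \<longrightarrow> (\<exists>g. aut g \<and> (\<forall>a \<in> A. g a = f a)))"

text \<open>
  \<open>ind A C B\<close> stands for the independence of \<open>A\<close> from \<open>B\<close> over \<open>C\<close>. Only its restriction to small sets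
  matters.
\<close>

locale stationary_independence =
  fixes S :: "('p, 'm, 'v) semantics"
    and \<kappa> :: "'k rel"
    and ind :: "'m set \<Rightarrow> 'm set \<Rightarrow> 'm set \<Rightarrow> bool"
  assumes invariance:
    "\<lbrakk>small S \<kappa> A; small S \<kappa> B; small S \<kappa> C; same_type S {} (A \<union> B \<union> C) id f\<rbrakk>
       \<Longrightarrow> ind A C B \<longleftrightarrow> ind (f ` A) (f ` C) (f ` B)"
  and monotonicity:
    "\<lbrakk>small S \<kappa> A; small S \<kappa> B; small S \<kappa> C; small S \<kappa> D; ind A C (B \<union> D)\<rbrakk>
       \<Longrightarrow> ind A C B \<and> ind A (B \<union> C) D"
  and transitivity:
    "\<lbrakk>small S \<kappa> A; small S \<kappa> B; small S \<kappa> C; small S \<kappa> D; ind A C B; ind A (B \<union> C) D\<rbrakk>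
       \<Longrightarrow> ind A C (B \<union> D)"
  and symmetry:
    "\<lbrakk>small S \<kappa> A; small S \<kappa> B; small S \<kappa> C\<rbrakk> \<Longrightarrow> ind A C B \<longleftrightarrow> ind B C A"
  and full_existence:
    "\<lbrakk>small S \<kappa> A; small S \<kappa> B; small S \<kappa> C\<rbrakk>
       \<Longrightarrow> \<exists>f. same_type S C A id f \<and> ind (f ` A) C B"
  and stationarity:
    "\<lbrakk>small S \<kappa> A; small S \<kappa> B; small S \<kappa> C; same_type S C A id f; ind A C B; ind (f ` A) C B\<rbrakk>
       \<Longrightarrow> same_type S (B \<union> C) A id f"

text \<open>
  \<open>tp(A/D)\<close> implies \<open>\<phi>(x,b)\<close> when \<open>\<phi>(x,b)\<close> holds at every realization of \<open>tp(A/D)\<close>; such a realization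
  is an \<open>f\<close> with \<open>same_type S D A id f\<close>, and \<open>e\<close> names the variables of \<open>tp(A/D)\<close> (indexed by \<open>A\<close>)
  that take the places of \<open>x\<close>. The parameters \<open>b\<close> are arbitrary.
\<close>

definition type_implies ::
    "('p, 'm, 'v) semantics \<Rightarrow> 'm set \<Rightarrow> 'm set \<Rightarrow> nat set \<Rightarrow> (nat \<Rightarrow> 'm) \<Rightarrow> 'p \<Rightarrow> (nat \<Rightarrow> 'm) \<Rightarrow> bool" where
  "type_implies S A D X e \<phi> b \<longleftrightarrow>
     (\<forall>f. same_type S D A id f \<longrightarrow> instance_holds S X \<phi> (f \<circ> e) b)"

definition nonforking ::
    "('p, 'm, 'v) semantics \<Rightarrow> ('m set \<Rightarrow> nat set \<Rightarrow> 'p \<Rightarrow> (nat \<Rightarrow> 'm) \<Rightarrow> bool) \<Rightarrow>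
     'm set \<Rightarrow> 'm set \<Rightarrow> 'm set \<Rightarrow> bool" where
  "nonforking S forks A C B \<longleftrightarrow>
     \<not> (\<exists>X e \<phi> b. finite X \<and> e ` X \<subseteq> A \<and> \<phi> \<in> formulas S \<and> b ` params S X \<phi> \<subseteq> points S \<and>
          type_implies S A (B \<union> C) X e \<phi> b \<and> forks C X \<phi> b)"

section \<open>Discrete logic\<close>

datatype ('f, 'r) fm =
    Eq "'f tm" "'f tm"
  | Rel 'r "'f tm list"
  | Neg "('f, 'r) fm"
  | Conj "('f, 'r) fm" "('f, 'r) fm"
  | Exi nat "('f, 'r) fm"

primrec fm_vars :: "('f, 'r) fm \<Rightarrow> nat set" where
  "fm_vars (Eq t u) = tm_vars t \<union> tm_vars u"
| "fm_vars (Rel r ts) = \<Union> (set (map tm_vars ts))"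
| "fm_vars (Neg \<phi>) = fm_vars \<phi>"
| "fm_vars (Conj \<phi> \<psi>) = fm_vars \<phi> \<union> fm_vars \<psi>"
| "fm_vars (Exi v \<phi>) = fm_vars \<phi> - {v}"

primrec wf_fm :: "('f, 'r) lang \<Rightarrow> ('f, 'r) fm \<Rightarrow> bool" where
  "wf_fm L (Eq t u) \<longleftrightarrow> wf_tm L t \<and> wf_tm L u"
| "wf_fm L (Rel r ts) \<longleftrightarrow> r \<in> rels L \<and> length ts = rel_arity L r \<and> list_all (wf_tm L) ts"
| "wf_fm L (Neg \<phi>) \<longleftrightarrow> wf_fm L \<phi>"
| "wf_fm L (Conj \<phi> \<psi>) \<longleftrightarrow> wf_fm L \<phi> \<and> wf_fm L \<psi>"
| "wf_fm L (Exi v \<phi>) \<longleftrightarrow> wf_fm L \<phi>"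

primrec sat :: "('f, 'r, 'm, bool) struct \<Rightarrow> ('f, 'r) fm \<Rightarrow> (nat \<Rightarrow> 'm) \<Rightarrow> bool" where
  "sat M (Eq t u) s \<longleftrightarrow> tm_val M s t = tm_val M s u"
| "sat M (Rel r ts) s \<longleftrightarrow> rel_of M r (map (tm_val M s) ts)"
| "sat M (Neg \<phi>) s \<longleftrightarrow> \<not> sat M \<phi> s"
| "sat M (Conj \<phi> \<psi>) s \<longleftrightarrow> sat M \<phi> s \<and> sat M \<psi> s"
| "sat M (Exi v \<phi>) s \<longleftrightarrow> (\<exists>x \<in> universe M. sat M \<phi> (s(v := x)))"

definition fo_sem ::
    "('f, 'r) lang \<Rightarrow> ('f, 'r, 'm, bool) struct \<Rightarrow> (('f, 'r) fm, 'm, bool) semantics" where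
  "fo_sem L M = \<lparr>points = universe M, formulas = {\<phi>. wf_fm L \<phi>}, free_vars = fm_vars,
     truth = sat M, designated = True\<rparr>"

definition fo_sentences :: "('f, 'r) lang \<Rightarrow> ('f, 'r) fm set" where
  "fo_sentences L = {\<sigma>. wf_fm L \<sigma> \<and> fm_vars \<sigma> = {}}"

definition fo_models :: "('f, 'r) lang \<Rightarrow> ('f, 'r, 'm, bool) struct \<Rightarrow> ('f, 'r) fm set \<Rightarrow> bool" where
  "fo_models L M T \<longleftrightarrow> closed_structure L M \<and>
     (\<forall>\<sigma> \<in> T. \<forall>s. range s \<subseteq> universe M \<longrightarrow> sat M \<sigma> s)"

text \<open>
  HOL cannot quantify over structures on all types at once. By the downward Loewenheim-Skolem
  theorem nothing is lost by considering only structures whose universe is a subset of a type of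
  cardinality at least \<open>|L| + \<aleph>\<^sub>0\<close>, such as \<open>'f + 'r + nat\<close>.
\<close>

definition fo_entails :: "('f, 'r) lang \<Rightarrow> ('f, 'r) fm set \<Rightarrow> ('f, 'r) fm \<Rightarrow> bool" where
  "fo_entails L T \<sigma> \<longleftrightarrow>
     (\<forall>N :: ('f, 'r, 'f + 'r + nat, bool) struct. fo_models L N T \<longrightarrow> fo_models L N {\<sigma>})"

definition fo_complete :: "('f, 'r) lang \<Rightarrow> ('f, 'r) fm set \<Rightarrow> bool" where
  "fo_complete L T \<longleftrightarrow> T \<subseteq> fo_sentences L \<and>
     (\<exists>N :: ('f, 'r, 'f + 'r + nat, bool) struct. fo_models L N T) \<and>
     (\<forall>\<sigma> \<in> fo_sentences L. fo_entails L T \<sigma> \<or> fo_entails L T (Neg \<sigma>))"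

definition fo_monster ::
    "('f, 'r) lang \<Rightarrow> ('f, 'r) fm set \<Rightarrow> 'k rel \<Rightarrow> ('f, 'r, 'm, bool) struct \<Rightarrow> bool" where
  "fo_monster L T \<kappa> M \<longleftrightarrow> fo_models L M T \<and>
     Card_order \<kappa> \<and> natLeq <o \<kappa> \<and> |funs L| <o \<kappa> \<and> |rels L| <o \<kappa> \<and>
     saturated (fo_sem L M) \<kappa> \<and> strongly_homogeneous (fo_sem L M) (automorphism L M) \<kappa>"

text \<open>
  As usual, \<open>k\<close>-inconsistency refers to the family \<open>(\<phi>(x,b\<^sup>l))\<close> indexed by \<open>l\<close>, i.e. to \<open>k\<close>-element sets
  of indices; otherwise a constant sequence would make every formula divide.
\<close>

definition fo_divides ::
    "('f, 'r) lang \<Rightarrow> ('f, 'r, 'm, bool) struct \<Rightarrow>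
     'm set \<Rightarrow> nat set \<Rightarrow> ('f, 'r) fm \<Rightarrow> (nat \<Rightarrow> 'm) \<Rightarrow> bool" where
  "fo_divides L M C X \<phi> b \<longleftrightarrow>
     (\<exists>bs :: nat \<Rightarrow> nat \<Rightarrow> 'm. \<exists>k > 0.
        (\<forall>l. same_type (fo_sem L M) C (params (fo_sem L M) X \<phi>) (bs l) b) \<and>
        (\<forall>K. finite K \<and> card K = k \<longrightarrow>
           \<not> (\<exists>a. a ` X \<subseteq> universe M \<and> (\<forall>l \<in> K. instance_val (fo_sem L M) X \<phi> a (bs l)))))"

definition fo_forks ::
    "('f, 'r) lang \<Rightarrow> ('f, 'r, 'm, bool) struct \<Rightarrow>
     'm set \<Rightarrow> nat set \<Rightarrow> ('f, 'r) fm \<Rightarrow> (nat \<Rightarrow> 'm) \<Rightarrow> bool" where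
  "fo_forks L M C X \<phi> b \<longleftrightarrow>
     (\<exists>\<Psi>. finite \<Psi> \<and> \<Psi> \<noteq> {} \<and>
        (\<forall>(\<psi>, d) \<in> \<Psi>. wf_fm L \<psi> \<and> d ` params (fo_sem L M) X \<psi> \<subseteq> universe M \<and>
           fo_divides L M C X \<psi> d) \<and>
        (\<forall>a. a ` X \<subseteq> universe M \<and> instance_val (fo_sem L M) X \<phi> a b \<longrightarrow>
           (\<exists>(\<psi>, d) \<in> \<Psi>. instance_val (fo_sem L M) X \<psi> a d)))"

definition fo_nonforking ::
    "('f, 'r) lang \<Rightarrow> ('f, 'r, 'm, bool) struct \<Rightarrow> 'm set \<Rightarrow> 'm set \<Rightarrow> 'm set \<Rightarrow> bool" where
  "fo_nonforking L M = nonforking (fo_sem L M) (fo_forks L M)"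

section \<open>Continuous logic\<close>

text \<open>
  Continuous logic for bounded complete metric structures, with diameter at most 1, predicates with
  values in \<open>[0,1]\<close>, and all continuous functions \<open>[0,1]\<^sup>n \<rightarrow> [0,1]\<close> as connectives. The language
  specifies moduli of uniform continuity.
\<close>

record ('f, 'r) clang = "('f, 'r) lang" +
  fun_mod :: "'f \<Rightarrow> real \<Rightarrow> real"
  rel_mod :: "'r \<Rightarrow> real \<Rightarrow> real"

record ('f, 'r, 'm) mstruct = "('f, 'r, 'm, real) struct" +
  mdistance :: "'m \<Rightarrow> 'm \<Rightarrow> real"

definition is_modulus :: "(real \<Rightarrow> real) \<Rightarrow> bool" where
  "is_modulus \<Delta> \<longleftrightarrow> (\<forall>\<epsilon>. 0 < \<epsilon> \<and> \<epsilon> \<le> 1 \<longrightarrow> 0 < \<Delta> \<epsilon> \<and> \<Delta> \<epsilon> \<le> 1)"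

definition clanguage :: "('f, 'r) clang \<Rightarrow> bool" where
  "clanguage L \<longleftrightarrow> (\<forall>f \<in> funs L. is_modulus (fun_mod L f)) \<and> (\<forall>r \<in> rels L. is_modulus (rel_mod L r))"

definition has_modulus ::
    "'m set \<Rightarrow> ('m \<Rightarrow> 'm \<Rightarrow> real) \<Rightarrow> nat \<Rightarrow> (real \<Rightarrow> real) \<Rightarrow> ('z \<Rightarrow> 'z \<Rightarrow> real) \<Rightarrow> ('m list \<Rightarrow> 'z) \<Rightarrow> bool" where
  "has_modulus U d n \<Delta> d' h \<longleftrightarrow>
     (\<forall>\<epsilon>. 0 < \<epsilon> \<and> \<epsilon> \<le> 1 \<longrightarrow>
        (\<forall>xs \<in> tuples U n. \<forall>ys \<in> tuples U n.
           (\<forall>i < n. d (xs ! i) (ys ! i) < \<Delta> \<epsilon>) \<longrightarrow> d' (h xs) (h ys) \<le> \<epsilon>))"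

definition metric_structure :: "('f, 'r) clang \<Rightarrow> ('f, 'r, 'm) mstruct \<Rightarrow> bool" where
  "metric_structure L M \<longleftrightarrow> closed_structure L M \<and>
     Metric_space (universe M) (mdistance M) \<and>
     Metric_space.mcomplete (universe M) (mdistance M) \<and>
     (\<forall>x \<in> universe M. \<forall>y \<in> universe M. mdistance M x y \<le> 1) \<and>
     (\<forall>f \<in> funs L.
        has_modulus (universe M) (mdistance M) (fun_arity L f) (fun_mod L f) (mdistance M) (fun_of M f)) \<and>
     (\<forall>r \<in> rels L.
        has_modulus (universe M) (mdistance M) (rel_arity L r) (rel_mod L r) dist (rel_of M r) \<and>
        rel_of M r ` tuples (universe M) (rel_arity L r) \<subseteq> {0..1})"

definition cautomorphism :: "('f, 'r) clang \<Rightarrow> ('f, 'r, 'm) mstruct \<Rightarrow> ('m \<Rightarrow> 'm) \<Rightarrow> bool" where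
  "cautomorphism L M g \<longleftrightarrow> automorphism L M g \<and>
     (\<forall>x \<in> universe M. \<forall>y \<in> universe M. mdistance M (g x) (g y) = mdistance M x y)"

text \<open>
  The cube \<open>[0,1]\<^sup>n\<close> is realized inside \<open>nat \<Rightarrow> real\<close>, with the product topology, by padding with zeros.
\<close>

definition pad :: "real list \<Rightarrow> nat \<Rightarrow> real" where
  "pad xs i = (if i < length xs then xs ! i else 0)"

definition cube :: "nat \<Rightarrow> (nat \<Rightarrow> real) set" where
  "cube n = pad ` tuples {0..1} n"

definition connective :: "nat \<Rightarrow> ((nat \<Rightarrow> real) \<Rightarrow> real) \<Rightarrow> bool" where
  "connective n u \<longleftrightarrow> continuous_on (cube n) u \<and> u ` cube n \<subseteq> {0..1}"

datatype ('f, 'r) cfm =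
    Dst "'f tm" "'f tm"
  | Prd 'r "'f tm list"
  | Con "(nat \<Rightarrow> real) \<Rightarrow> real" "('f, 'r) cfm list"
  | SupQ nat "('f, 'r) cfm"
  | InfQ nat "('f, 'r) cfm"

primrec cfm_vars :: "('f, 'r) cfm \<Rightarrow> nat set" where
  "cfm_vars (Dst t u) = tm_vars t \<union> tm_vars u"
| "cfm_vars (Prd r ts) = \<Union> (set (map tm_vars ts))"
| "cfm_vars (Con u \<phi>s) = \<Union> (set (map cfm_vars \<phi>s))"
| "cfm_vars (SupQ v \<phi>) = cfm_vars \<phi> - {v}"
| "cfm_vars (InfQ v \<phi>) = cfm_vars \<phi> - {v}"

primrec wf_cfm :: "('f, 'r) clang \<Rightarrow> ('f, 'r) cfm \<Rightarrow> bool" where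
  "wf_cfm L (Dst t u) \<longleftrightarrow> wf_tm L t \<and> wf_tm L u"
| "wf_cfm L (Prd r ts) \<longleftrightarrow> r \<in> rels L \<and> length ts = rel_arity L r \<and> list_all (wf_tm L) ts"
| "wf_cfm L (Con u \<phi>s) \<longleftrightarrow> connective (length \<phi>s) u \<and> list_all id (map (wf_cfm L) \<phi>s)"
| "wf_cfm L (SupQ v \<phi>) \<longleftrightarrow> wf_cfm L \<phi>"
| "wf_cfm L (InfQ v \<phi>) \<longleftrightarrow> wf_cfm L \<phi>"

primrec cval :: "('f, 'r, 'm) mstruct \<Rightarrow> ('f, 'r) cfm \<Rightarrow> (nat \<Rightarrow> 'm) \<Rightarrow> real" where
  "cval M (Dst t u) s = mdistance M (tm_val M s t) (tm_val M s u)"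
| "cval M (Prd r ts) s = rel_of M r (map (tm_val M s) ts)"
| "cval M (Con u \<phi>s) s = u (pad (map (\<lambda>h. h s) (map (cval M) \<phi>s)))"
| "cval M (SupQ v \<phi>) s = (SUP x \<in> universe M. cval M \<phi> (s(v := x)))"
| "cval M (InfQ v \<phi>) s = (INF x \<in> universe M. cval M \<phi> (s(v := x)))"

definition cont_sem ::
    "('f, 'r) clang \<Rightarrow> ('f, 'r, 'm) mstruct \<Rightarrow> (('f, 'r) cfm, 'm, real) semantics" where
  "cont_sem L M = \<lparr>points = universe M, formulas = {\<phi>. wf_cfm L \<phi>}, free_vars = cfm_vars,
     truth = cval M, designated = 0\<rparr>"

definition cont_sentences :: "('f, 'r) clang \<Rightarrow> ('f, 'r) cfm set" where
  "cont_sentences L = {\<sigma>. wf_cfm L \<sigma> \<and> cfm_vars \<sigma> = {}}"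

text \<open>A theory is a set of closed conditions \<open>\<sigma> = 0\<close>, represented by the sentences \<open>\<sigma>\<close>.\<close>

definition cont_models :: "('f, 'r) clang \<Rightarrow> ('f, 'r, 'm) mstruct \<Rightarrow> ('f, 'r) cfm set \<Rightarrow> bool" where
  "cont_models L M T \<longleftrightarrow> metric_structure L M \<and>
     (\<forall>\<sigma> \<in> T. \<forall>s. range s \<subseteq> universe M \<longrightarrow> cval M \<sigma> s = 0)"

text \<open>
  By the downward Loewenheim-Skolem theorem it suffices to consider structures of density character at
  most \<open>|L| + \<aleph>\<^sub>0\<close>; these have cardinality at most \<open>(|L| + \<aleph>\<^sub>0)\<^bsup>\<aleph>\<^sub>0\<^esup>\<close>, hence are isomorphic to structures
  whose universe is a subset of the type \<open>nat \<Rightarrow> 'f + 'r + nat\<close>.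
\<close>

definition cont_entails :: "('f, 'r) clang \<Rightarrow> ('f, 'r) cfm set \<Rightarrow> ('f, 'r) cfm \<Rightarrow> bool" where
  "cont_entails L T \<sigma> \<longleftrightarrow>
     (\<forall>N :: ('f, 'r, nat \<Rightarrow> 'f + 'r + nat) mstruct. cont_models L N T \<longrightarrow> cont_models L N {\<sigma>})"

text \<open>
  A continuous theory is complete if its set of consequences is the theory of a structure, that is,
  the set of all closed conditions true in that structure.
\<close>

definition cont_complete :: "('f, 'r) clang \<Rightarrow> ('f, 'r) cfm set \<Rightarrow> bool" where
  "cont_complete L T \<longleftrightarrow> T \<subseteq> cont_sentences L \<and>
     (\<exists>N :: ('f, 'r, nat \<Rightarrow> 'f + 'r + nat) mstruct. metric_structure L N \<and>
        (\<forall>\<sigma> \<in> cont_sentences L. cont_entails L T \<sigma> \<longleftrightarrow> cont_models L N {\<sigma>}))"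

definition cont_monster ::
    "('f, 'r) clang \<Rightarrow> ('f, 'r) cfm set \<Rightarrow> 'k rel \<Rightarrow> ('f, 'r, 'm) mstruct \<Rightarrow> bool" where
  "cont_monster L T \<kappa> M \<longleftrightarrow> cont_models L M T \<and>
     Card_order \<kappa> \<and> natLeq <o \<kappa> \<and> |funs L| <o \<kappa> \<and> |rels L| <o \<kappa> \<and>
     saturated (cont_sem L M) \<kappa> \<and> strongly_homogeneous (cont_sem L M) (cautomorphism L M) \<kappa>"

definition cont_divides ::
    "('f, 'r) clang \<Rightarrow> ('f, 'r, 'm) mstruct \<Rightarrow>
     'm set \<Rightarrow> nat set \<Rightarrow> ('f, 'r) cfm \<Rightarrow> (nat \<Rightarrow> 'm) \<Rightarrow> bool" where
  "cont_divides L M C X \<phi> b \<longleftrightarrow>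
     (\<exists>bs :: nat \<Rightarrow> nat \<Rightarrow> 'm. \<exists>\<epsilon> > 0. \<exists>k > 0.
        (\<forall>l. same_type (cont_sem L M) C (params (cont_sem L M) X \<phi>) (bs l) b) \<and>
        (\<forall>K. finite K \<and> card K = k \<longrightarrow>
           \<not> (\<exists>a. a ` X \<subseteq> universe M \<and> (\<forall>l \<in> K. instance_val (cont_sem L M) X \<phi> a (bs l) \<le> \<epsilon>))))"

definition cont_forks ::
    "('f, 'r) clang \<Rightarrow> ('f, 'r, 'm) mstruct \<Rightarrow>
     'm set \<Rightarrow> nat set \<Rightarrow> ('f, 'r) cfm \<Rightarrow> (nat \<Rightarrow> 'm) \<Rightarrow> bool" where
  "cont_forks L M C X \<phi> b \<longleftrightarrow>
     (\<exists>\<Psi>. finite \<Psi> \<and> \<Psi> \<noteq> {} \<and>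
        (\<forall>(\<psi>, d) \<in> \<Psi>. wf_cfm L \<psi> \<and> d ` params (cont_sem L M) X \<psi> \<subseteq> universe M \<and>
           cont_divides L M C X \<psi> d) \<and>
        (\<forall>a. a ` X \<subseteq> universe M \<and> instance_val (cont_sem L M) X \<phi> a b = 0 \<longrightarrow>
           Min ((\<lambda>(\<psi>, d). instance_val (cont_sem L M) X \<psi> a d) ` \<Psi>) = 0))"

definition cont_nonforking ::
    "('f, 'r) clang \<Rightarrow> ('f, 'r, 'm) mstruct \<Rightarrow> 'm set \<Rightarrow> 'm set \<Rightarrow> 'm set \<Rightarrow> bool" where
  "cont_nonforking L M = nonforking (cont_sem L M) (cont_forks L M)"

end

theory Submission
  imports Defs "HOL-Library.Countable_Set_Type"
begin

text \<open>
  Suppose \<open>A\<close> is independent from \<open>d\<close> over \<open>C\<close> and \<open>(d\<^sup>l)\<close> is any sequence of realizations of \<open>tp(d/C)\<close>. By full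
  existence some \<open>A' \<equiv>\<^sub>C A\<close> is independent from all the \<open>d\<^sup>l\<close> at once. For each \<open>l\<close>, an automorphism
  over \<open>C\<close> that takes \<open>d\<close> to \<open>d\<^sup>l\<close> takes \<open>A\<close> to some \<open>A\<^sub>l\<close> independent from \<open>d\<^sup>l\<close>, and stationarity yields
  \<open>A' \<equiv> A\<^sub>l\<close> over \<open>C d\<^sup>l\<close>. So \<open>A' d\<^sup>l \<equiv>\<^sub>C A d\<close> for all \<open>l\<close>, and no formula in \<open>tp(A/Cd)\<close> divides over \<open>C\<close>.
  For forking, full existence and transitivity first replace \<open>A\<close> by a realization of \<open>tp(A/BC)\<close> that
  is independent over \<open>C\<close> from the parameters of all the dividing formulas.
\<close>

section \<open>Types and independence in a strongly homogeneous structure\<close>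

lemma same_type_points:
  assumes "same_type S C I a a'"
  shows "a ` I \<subseteq> points S" "a' ` I \<subseteq> points S"
  using assms by (auto simp: same_type_def)

lemma same_type_truth:
  assumes "same_type S C I a a'" "\<phi> \<in> formulas S" "s ` free_vars S \<phi> \<subseteq> I <+> C"
  shows "truth S \<phi> (case_sum a id \<circ> s) = truth S \<phi> (case_sum a' id \<circ> s)"
  using assms by (auto simp: same_type_def)

lemma same_type_sym: "same_type S C I a a' \<Longrightarrow> same_type S C I a' a"
  by (auto simp: same_type_def)

lemma same_type_trans: "same_type S C I a b \<Longrightarrow> same_type S C I b c \<Longrightarrow> same_type S C I a c"
  by (auto simp: same_type_def)

text \<open>Collects what discrete and continuous logic share, so that the argument is carried out
  once for both. Truth values are left abstract, and \<open>aut\<close> is a parameter because in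
  continuous logic automorphisms must also preserve the metric. \<open>equality_formula\<close> lets
  types detect equality of elements: it is the atomic formula for equality in one logic and the
  distance, with value 0, in the other.\<close>

locale homogeneous_semantics =
  fixes S :: "('p, 'm, 'v) semantics"
    and aut :: "('m \<Rightarrow> 'm) \<Rightarrow> bool"
    and \<kappa> :: "'k rel"
  assumes coincidence:
    "\<lbrakk>\<phi> \<in> formulas S; \<And>v. v \<in> free_vars S \<phi> \<Longrightarrow> s v = s' v\<rbrakk> \<Longrightarrow> truth S \<phi> s = truth S \<phi> s'"
  and finite_free_vars: "\<phi> \<in> formulas S \<Longrightarrow> finite (free_vars S \<phi>)"
  and equality_formula:
    "\<exists>\<phi> \<in> formulas S. free_vars S \<phi> = {0, 1} \<and>
       (\<forall>s. s 0 \<in> points S \<and> s 1 \<in> points S \<longrightarrow> (truth S \<phi> s = designated S \<longleftrightarrow> s 0 = s 1))"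
  and aut_points: "\<lbrakk>aut g; x \<in> points S\<rbrakk> \<Longrightarrow> g x \<in> points S"
  and aut_truth:
    "\<lbrakk>aut g; \<phi> \<in> formulas S; s ` free_vars S \<phi> \<subseteq> points S\<rbrakk> \<Longrightarrow> truth S \<phi> (g \<circ> s) = truth S \<phi> s"
  and homogeneous: "strongly_homogeneous S aut \<kappa>"
  and card_order: "Card_order \<kappa>"
  and uncountable: "natLeq <o \<kappa>"
begin

section \<open>Small sets\<close>

lemma small_Un: "small S \<kappa> A \<Longrightarrow> small S \<kappa> B \<Longrightarrow> small S \<kappa> (A \<union> B)"
proof -
  have "natLeq \<le>o \<kappa>"
    using uncountable ordLess_imp_ordLeq by blast
  then have "infinite (Field \<kappa>)"
    using card_order cinfinite_mono natLeq_cinfinite by (auto simp: cinfinite_def)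
  then show "small S \<kappa> A \<Longrightarrow> small S \<kappa> B \<Longrightarrow> small S \<kappa> (A \<union> B)"
    using card_of_Un_ordLess_infinite_Field[OF _ card_order] by (auto simp: small_def)
qed

lemma small_subset: "small S \<kappa> B \<Longrightarrow> A \<subseteq> B \<Longrightarrow> small S \<kappa> A"
  by (meson card_of_mono1 dual_order.trans ordLeq_ordLess_trans small_def)

lemma small_image: "small S \<kappa> A \<Longrightarrow> f ` A \<subseteq> points S \<Longrightarrow> small S \<kappa> (f ` A)"
  by (meson card_of_image ordLeq_ordLess_trans small_def)

text \<open>Full existence is applied below to the union of a sequence of finite tuples, which is
  countable; this is why \<open>\<kappa>\<close> has to lie above \<open>natLeq\<close>.\<close>

lemma small_countable: "countable A \<Longrightarrow> A \<subseteq> points S \<Longrightarrow> small S \<kappa> A"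
  using uncountable ordLeq_ordLess_trans by (auto simp: small_def countable_card_le_natLeq)

text \<open>Evaluate the equality formula with its two variables assigned \<open>u\<close> and
  \<open>w\<close>. As a consequence, correspondences between tuples of the same type are well
  defined and injective, including on entries that lie in \<open>C\<close>.\<close>

lemma same_type_eq_iff:
  assumes "same_type S C I a a'" "C \<subseteq> points S" "u \<in> I <+> C" "w \<in> I <+> C"
  shows "case_sum a id u = case_sum a id w \<longleftrightarrow> case_sum a' id u = case_sum a' id w"
proof -
  obtain \<phi> where \<phi>: "\<phi> \<in> formulas S" "free_vars S \<phi> = {0, 1}"
    and eq: "\<forall>s. s 0 \<in> points S \<and> s 1 \<in> points S \<longrightarrow> (truth S \<phi> s = designated S \<longleftrightarrow> s 0 = s 1)"
    using equality_formula by (elim bexE conjE) (rule that)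
  define s :: "nat \<Rightarrow> _" where "s v = (if v = 0 then u else w)" for v
  have pts: "case_sum b id t \<in> points S" if "b ` I \<subseteq> points S" "t \<in> I <+> C" for b t
    using that assms(2) by auto
  have "truth S \<phi> (case_sum a id \<circ> s) = truth S \<phi> (case_sum a' id \<circ> s)"
    using assms(3,4) \<phi>(2) by (intro same_type_truth[OF assms(1) \<phi>(1)]) (simp add: s_def)
  moreover have "truth S \<phi> (case_sum b id \<circ> s) = designated S \<longleftrightarrow> case_sum b id u = case_sum b id w"
    if "b ` I \<subseteq> points S" for b
    using eq[rule_format, of "case_sum b id \<circ> s"] pts[OF that assms(3)] pts[OF that assms(4)] by (simp add: s_def)
  ultimately show ?thesis
    using same_type_points[OF assms(1)] by metis
qed

text \<open>Strong homogeneity speaks of a set enumerated by itself, over no parameters. So the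
  tuple and \<open>C\<close> are merged into one set, and the correspondence \<open>a i\<close> to
  \<open>a' i\<close>, \<open>c\<close> to \<open>c\<close> becomes a map on that set.\<close>

lemma ex_aut:
  assumes st: "same_type S C I a a'" and sm: "small S \<kappa> C" "small S \<kappa> (a ` I)"
  shows "\<exists>g. aut g \<and> (\<forall>c \<in> C. g c = c) \<and> (\<forall>i \<in> I. g (a i) = a' i)"
proof -
  have C: "C \<subseteq> points S"
    using sm by (simp add: small_def)
  let ?A = "a ` I \<union> C"
  have "\<exists>u. u \<in> I <+> C \<and> case_sum a id u = x" if "x \<in> ?A" for x
    using that by force
  \<comment> \<open>An element of \<open>?A\<close> may have several names: a repeated entry, or an
    entry that is also a parameter. \<open>p\<close> picks one of them.\<close>
  then obtain p where p: "\<And>x. x \<in> ?A \<Longrightarrow> p x \<in> I <+> C \<and> case_sum a id (p x) = x"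
    by metis
  define f where "f = case_sum a' id \<circ> p"
  \<comment> \<open>The choice made by \<open>p\<close> is harmless: two names that agree under
    \<open>a\<close> also agree under \<open>a'\<close>.\<close>
  have f: "f (case_sum a id u) = case_sum a' id u" if "u \<in> I <+> C" for u
  proof -
    have "case_sum a id u \<in> ?A"
      using that by auto
    then show ?thesis
      using same_type_eq_iff[OF st C _ that] p unfolding f_def by (metis comp_apply)
  qed
  have "same_type S {} ?A id f"
    unfolding same_type_def
  proof (intro conjI ballI allI impI)
    show "id ` ?A \<subseteq> points S"
      using C same_type_points[OF st] by auto
    show "f ` ?A \<subseteq> points S"
    proof
      fix y assume "y \<in> f ` ?A"
      then obtain x where x: "x \<in> ?A" "y = case_sum a' id (p x)"
        by (auto simp: f_def)
      then show "y \<in> points S"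
        using p[OF x(1)] C same_type_points(2)[OF st] by auto
    qed
    fix \<phi> and s :: "nat \<Rightarrow> 'm + 'm"
    assume \<phi>: "\<phi> \<in> formulas S" and s: "s ` free_vars S \<phi> \<subseteq> ?A <+> {}"
    \<comment> \<open>\<open>t\<close> replaces each element by its chosen name, so that the
      hypothesis about the types of \<open>a\<close> and \<open>a'\<close> over \<open>C\<close>
      applies.\<close>
    define t where "t = p \<circ> projl \<circ> s"
    have s': "\<exists>x \<in> ?A. s v = Inl x" if "v \<in> free_vars S \<phi>" for v
      using s that by blast
    have "t ` free_vars S \<phi> \<subseteq> I <+> C"
    proof
      fix y assume "y \<in> t ` free_vars S \<phi>"
      then obtain v where "v \<in> free_vars S \<phi>" "y = t v" by blast
      with s' p show "y \<in> I <+> C" by (fastforce simp: t_def)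
    qed
    then have "truth S \<phi> (case_sum a id \<circ> t) = truth S \<phi> (case_sum a' id \<circ> t)"
      using same_type_truth[OF st \<phi>] by blast
    moreover have "truth S \<phi> (case_sum id id \<circ> s) = truth S \<phi> (case_sum a id \<circ> t)"
    proof (rule coincidence[OF \<phi>])
      fix v assume "v \<in> free_vars S \<phi>"
      with s' obtain x where "x \<in> ?A" "s v = Inl x" by blast
      then show "(case_sum id id \<circ> s) v = (case_sum a id \<circ> t) v"
        using p by (simp add: t_def)
    qed
    moreover have "truth S \<phi> (case_sum f id \<circ> s) = truth S \<phi> (case_sum a' id \<circ> t)"
    proof (rule coincidence[OF \<phi>])
      fix v assume "v \<in> free_vars S \<phi>"
      with s' obtain x where "x \<in> ?A" "s v = Inl x" by blast
      then show "(case_sum f id \<circ> s) v = (case_sum a' id \<circ> t) v"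
        by (simp add: t_def f_def)
    qed
    ultimately show "truth S \<phi> (case_sum id id \<circ> s) = truth S \<phi> (case_sum f id \<circ> s)"
      by simp
  qed
  then obtain g where g: "aut g" "\<And>x. x \<in> ?A \<Longrightarrow> g x = f x"
    using homogeneous small_Un[OF sm(2,1)] unfolding strongly_homogeneous_def by blast
  moreover have "g c = c" if "c \<in> C" for c
    using g(2) f[of "Inr c"] that by auto
  moreover have "g (a i) = a' i" if "i \<in> I" for i
    using g(2) f[of "Inl i"] that by auto
  ultimately show ?thesis by blast
qed

text \<open>Converse direction to \<open>ex_aut\<close>: truth is preserved by \<open>g\<close>, and
  parameters from \<open>C\<close> stay in place.\<close>

lemma same_type_aut:
  assumes g: "aut g" and fix_C: "\<And>c. c \<in> C \<Longrightarrow> g c = c" and pts: "C \<subseteq> points S" "a ` I \<subseteq> points S"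
  shows "same_type S C I a (g \<circ> a)"
  unfolding same_type_def
proof (intro conjI ballI allI impI)
  show "a ` I \<subseteq> points S" "(g \<circ> a) ` I \<subseteq> points S"
    using pts aut_points[OF g] by auto
  fix \<phi> and s :: "nat \<Rightarrow> 'a + 'm"
  assume \<phi>: "\<phi> \<in> formulas S" and s: "s ` free_vars S \<phi> \<subseteq> I <+> C"
  have s': "s v \<in> I <+> C" if "v \<in> free_vars S \<phi>" for v
    using s that by blast
  have "(case_sum a id \<circ> s) ` free_vars S \<phi> \<subseteq> points S"
    using s' pts by fastforce
  from aut_truth[OF g \<phi> this]
  have "truth S \<phi> (case_sum a id \<circ> s) = truth S \<phi> (g \<circ> (case_sum a id \<circ> s))" ..
  also have "\<dots> = truth S \<phi> (case_sum (g \<circ> a) id \<circ> s)"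
    using s' fix_C by (intro coincidence[OF \<phi>]) fastforce
  finally show "truth S \<phi> (case_sum a id \<circ> s) = truth S \<phi> (case_sum (g \<circ> a) id \<circ> s)" .
qed

end

section \<open>From stationary independence to nonforking, for both logics\<close>

locale homogeneous_independence =
  homogeneous_semantics S aut \<kappa> + stationary_independence S \<kappa> ind
  for S :: "('p, 'm, 'v) semantics" and aut :: "('m \<Rightarrow> 'm) \<Rightarrow> bool" and \<kappa> :: "'k rel"
    and ind :: "'m set \<Rightarrow> 'm set \<Rightarrow> 'm set \<Rightarrow> bool"
begin

text \<open>An automorphism preserves the type of \<open>A \<union> B \<union> C\<close> over the
  empty set, so invariance applies; fixing \<open>C\<close> pointwise keeps the base
  unchanged.\<close>

lemma ind_aut:
  assumes "aut g" "small S \<kappa> A" "small S \<kappa> B" "small S \<kappa> C" "\<And>c. c \<in> C \<Longrightarrow> g c = c" "ind A C B"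
  shows "ind (g ` A) C (g ` B)"
proof -
  have "same_type S {} (A \<union> B \<union> C) id g"
    using same_type_aut[OF assms(1), of "{}" id "A \<union> B \<union> C"] assms(2-4) by (auto simp: small_def)
  moreover have "g ` C = C"
    using assms(5) by force
  ultimately show ?thesis
    using invariance[OF assms(2-4)] assms(6) by metis
qed

lemma ind_subset:
  assumes "ind A C D" "B \<subseteq> D" "small S \<kappa> A" "small S \<kappa> C" "small S \<kappa> D"
  shows "ind A C B"
  using monotonicity[of A B C D] assms small_subset by (metis Un_absorb1)

text \<open>The core of the argument: one tuple serves for every member of the sequence
  simultaneously. The conclusion equates truth values instead of asserting truth, which makes it
  usable in both logics.\<close>

lemma ex_common_realization:
  assumes sm: "small S \<kappa> A" "small S \<kappa> C" "small S \<kappa> D" and ind: "ind A C D"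
    and \<psi>: "\<psi> \<in> formulas S" and e: "e ` X \<subseteq> A" and d: "d ` params S X \<psi> \<subseteq> D"
    and ds: "\<And>l :: nat. same_type S C (params S X \<psi>) (ds l) d"
  shows "\<exists>a. a ` X \<subseteq> points S \<and> (\<forall>l. instance_val S X \<psi> a (ds l) = instance_val S X \<psi> e d)"
proof -
  let ?P = "params S X \<psi>"
  have finP: "finite ?P"
    using finite_free_vars[OF \<psi>] by (simp add: params_def)
  define E where "E = (\<Union>l. ds l ` ?P)"
  have A: "A \<subseteq> points S" and C: "C \<subseteq> points S" and D: "D \<subseteq> points S"
    using sm by (auto simp: small_def)
  \<comment> \<open>A formula has finitely many free variables, so \<open>E\<close> is a countable
    union of finite sets.\<close>
  have smE: "small S \<kappa> E"
    using same_type_points(1)[OF ds] finP unfolding E_def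
    by (intro small_countable) (auto intro: countable_finite)
  obtain h where h: "same_type S C A id h" and hE: "ind (h ` A) C E"
    using full_existence[OF sm(1) smE sm(2)] by blast
  have hA: "h ` A \<subseteq> points S"
    using same_type_points(2)[OF h] .
  have smhA: "small S \<kappa> (h ` A)"
    using small_image[OF sm(1) hA] .
  \<comment> \<open>Needed to compare two copies of \<open>A\<close> by the map \<open>g\<close>
    after the inverse of \<open>h\<close>.\<close>
  have inj: "inj_on h A"
  proof (rule inj_onI)
    fix x y assume "x \<in> A" "y \<in> A" "h x = h y"
    then show "x = y"
      using same_type_eq_iff[OF h C, of "Inl x" "Inl y"] by auto
  qed
  have "instance_val S X \<psi> (h \<circ> e) (ds l) = instance_val S X \<psi> e d" for l
  proof -
    have smd: "small S \<kappa> (d ` ?P)"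
      using small_subset[OF sm(3) d] .
    obtain g where g: "aut g" "\<And>c. c \<in> C \<Longrightarrow> g c = c" "\<And>i. i \<in> ?P \<Longrightarrow> g (d i) = ds l i"
      using ex_aut[OF same_type_sym[OF ds[of l]] sm(2) smd] by blast
    have gd: "g ` d ` ?P = ds l ` ?P"
      using g(3) by (force simp: image_image)
    let ?El = "ds l ` ?P"
    have El: "?El \<subseteq> E"
      by (auto simp: E_def)
    have ind_g: "ind (g ` A) C ?El"
      using ind_aut[OF g(1) sm(1) smd sm(2) g(2)] ind_subset[OF ind d sm] gd by simp
    have ind_h: "ind (h ` A) C ?El"
      using ind_subset[OF hE El smhA sm(2) smE] .
    \<comment> \<open>Stationarity compares a set enumerated by itself with its image, so
      \<open>h\<close> A\<open>is enumerated by itself and\<close>f\<open>sends it to\<close>g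
      \<open>A\<close>.\<close>
    define f where "f = g \<circ> inv_into A h"
    have f: "f (h x) = g x" if "x \<in> A" for x
      using that inj by (simp add: f_def)
    have fh: "f ` h ` A = g ` A"
      using f by (force simp: image_image)
    have "same_type S C A h g"
      using same_type_trans[OF same_type_sym[OF h], of g] same_type_aut[OF g(1,2) C, of id A] A
      by auto
    have st: "same_type S C (h ` A) id f"
      unfolding same_type_def
    proof (intro conjI ballI allI impI)
      show "id ` h ` A \<subseteq> points S" "f ` h ` A \<subseteq> points S"
        using hA fh aut_points[OF g(1)] A by auto
      fix \<phi> and s :: "nat \<Rightarrow> 'm + 'm"
      assume \<phi>: "\<phi> \<in> formulas S" and s: "s ` free_vars S \<phi> \<subseteq> h ` A <+> C"
      define t where "t = map_sum (inv_into A h) id \<circ> s"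
      have s': "s v \<in> h ` A <+> C" if "v \<in> free_vars S \<phi>" for v
        using s that by blast
      have "t ` free_vars S \<phi> \<subseteq> A <+> C"
        using s' inj by (fastforce simp: t_def)
      then have "truth S \<phi> (case_sum h id \<circ> t) = truth S \<phi> (case_sum g id \<circ> t)"
        using same_type_truth[OF \<open>same_type S C A h g\<close> \<phi>] by blast
      moreover have "truth S \<phi> (case_sum id id \<circ> s) = truth S \<phi> (case_sum h id \<circ> t)"
        using s' inj by (intro coincidence[OF \<phi>]) (fastforce simp: t_def)
      moreover have "truth S \<phi> (case_sum f id \<circ> s) = truth S \<phi> (case_sum g id \<circ> t)"
        using s' inj by (intro coincidence[OF \<phi>]) (fastforce simp: t_def f_def)
      ultimately show "truth S \<phi> (case_sum id id \<circ> s) = truth S \<phi> (case_sum f id \<circ> s)"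
        by simp
    qed
    have st': "same_type S (?El \<union> C) (h ` A) id f"
      using stationarity[OF smhA small_subset[OF smE El] sm(2) st ind_h] fh ind_g by simp
    \<comment> \<open>The variables in \<open>X\<close> become entries of the tuple and the others
      parameters. Passing from \<open>id\<close> to \<open>f\<close> then turns
      \<open>h (e v)\<close> into \<open>g (e v)\<close> and leaves \<open>ds l v\<close>, which is
      \<open>g (d v)\<close>, fixed.\<close>
    define s where "s v = (if v \<in> X then Inl (h (e v)) else Inr (ds l v))" for v
    have s: "s ` free_vars S \<psi> \<subseteq> h ` A <+> (?El \<union> C)"
      using e by (auto simp: s_def params_def)
    have "instance_val S X \<psi> (h \<circ> e) (ds l) = truth S \<psi> (case_sum id id \<circ> s)"
      unfolding instance_val_def by (rule coincidence[OF \<psi>]) (auto simp: s_def override_on_def)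
    also have "\<dots> = truth S \<psi> (case_sum f id \<circ> s)"
      using same_type_truth[OF st' \<psi> s] .
    also have "\<dots> = truth S \<psi> (g \<circ> override_on d e X)"
      using g(3) f e by (intro coincidence[OF \<psi>]) (auto simp: s_def override_on_def params_def)
    also have "\<dots> = truth S \<psi> (override_on d e X)"
    proof (rule aut_truth[OF g(1) \<psi>])
      show "override_on d e X ` free_vars S \<psi> \<subseteq> points S"
      proof
        fix x assume "x \<in> override_on d e X ` free_vars S \<psi>"
        then have "x \<in> e ` X \<union> d ` ?P"
          by (auto simp: override_on_def params_def split: if_splits)
        then show "x \<in> points S"
          using e A d D by blast
      qed
    qed
    finally show ?thesis
      by (simp add: instance_val_def)
  qed
  moreover have "(h \<circ> e) ` X \<subseteq> points S"
    using hA e by auto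
  ultimately show ?thesis by blast
qed

text \<open>Dividing and forking are abstract here because their definitions differ between the
  logics. \<open>not_divides\<close> asks for a contradiction from a common realization along every
  sequence; \<open>forks\<close> asks for a finite cover by dividing formulas.\<close>

lemma nonforkingI:
  assumes sm: "small S \<kappa> A" "small S \<kappa> B" "small S \<kappa> C" and ind: "ind A C B"
    and not_divides: "\<And>X \<psi> d a. \<lbrakk>\<psi> \<in> formulas S; divides C X \<psi> d; instance_holds S X \<psi> a d;
        \<And>ds. \<forall>l :: nat. same_type S C (params S X \<psi>) (ds l) d \<Longrightarrow>
          \<exists>a'. a' ` X \<subseteq> points S \<and> (\<forall>l. instance_val S X \<psi> a' (ds l) = instance_val S X \<psi> a d)\<rbrakk>
        \<Longrightarrow> False"
    and forks: "\<And>X \<phi> b. forks C X \<phi> b \<Longrightarrow> \<exists>\<Psi>. finite \<Psi> \<and>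
        (\<forall>(\<psi>, d) \<in> \<Psi>. \<psi> \<in> formulas S \<and> d ` params S X \<psi> \<subseteq> points S \<and> divides C X \<psi> d) \<and>
        (\<forall>a. a ` X \<subseteq> points S \<and> instance_holds S X \<phi> a b \<longrightarrow>
           (\<exists>(\<psi>, d) \<in> \<Psi>. instance_holds S X \<psi> a d))"
  shows "nonforking S forks A C B"
  unfolding nonforking_def
proof (rule notI, elim exE conjE)
  fix X e \<phi> b
  assume e: "e ` X \<subseteq> A" and impl: "type_implies S A (B \<union> C) X e \<phi> b" and fk: "forks C X \<phi> b"
  obtain \<Psi> where fin: "finite \<Psi>"
    and \<Psi>: "\<And>\<psi> d. (\<psi>, d) \<in> \<Psi> \<Longrightarrow>
      \<psi> \<in> formulas S \<and> d ` params S X \<psi> \<subseteq> points S \<and> divides C X \<psi> d"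
    and cover: "\<And>a. a ` X \<subseteq> points S \<Longrightarrow> instance_holds S X \<phi> a b \<Longrightarrow>
      \<exists>\<psi> d. (\<psi>, d) \<in> \<Psi> \<and> instance_holds S X \<psi> a d"
    using forks[OF fk] by fast
  \<comment> \<open>All parameters of the dividing formulas in the cover; finitely many, hence a
    small set.\<close>
  define D where "D = (\<Union>(\<psi>, d) \<in> \<Psi>. d ` params S X \<psi>)"
  have "finite D"
    unfolding D_def using fin \<Psi> finite_free_vars by (auto simp: params_def)
  moreover have "D \<subseteq> points S"
    unfolding D_def using \<Psi> by fast
  ultimately have smD: "small S \<kappa> D"
    by (intro small_countable countable_finite)
  have smBC: "small S \<kappa> (B \<union> C)"
    using small_Un sm by blast
  \<comment> \<open>Moves \<open>A\<close> within its type over \<open>B \<union> C\<close> to a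
    position independent from \<open>D\<close>.\<close>
  obtain f where f: "same_type S (B \<union> C) A id f" and fD: "ind (f ` A) (B \<union> C) D"
    using full_existence[OF sm(1) smD smBC] by blast
  have fA: "f ` A \<subseteq> points S"
    using same_type_points(2)[OF f] .
  have smfA: "small S \<kappa> (f ` A)"
    using small_image[OF sm(1) fA] .
  obtain g where g: "aut g" "\<And>c. c \<in> B \<union> C \<Longrightarrow> g c = c" "\<And>x. x \<in> A \<Longrightarrow> g x = f x"
    using ex_aut[OF f smBC] sm(1) by auto
  have "g ` A = f ` A" "g ` B = B"
    using g by force+
  then have "ind (f ` A) C B"
    using ind_aut[OF g(1) sm(1) sm(2) sm(3) _ ind] g(2) by auto
  then have "ind (f ` A) C (B \<union> D)"
    using transitivity[OF smfA sm(2,3) smD] fD by blast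
  then have indD: "ind (f ` A) C D"
    using ind_subset[OF _ _ smfA sm(3) small_Un[OF sm(2) smD]] by blast
  \<comment> \<open>The moved tuple still realizes the type over \<open>B \<union> C\<close>, so it
    satisfies the forking formula and hence some dividing formula of the cover.\<close>
  have "instance_holds S X \<phi> (f \<circ> e) b"
    using impl f by (auto simp: type_implies_def)
  moreover have "(f \<circ> e) ` X \<subseteq> points S"
    using e fA by auto
  ultimately obtain \<psi> d where \<psi>: "(\<psi>, d) \<in> \<Psi>" "instance_holds S X \<psi> (f \<circ> e) d"
    using cover by blast
  have "(f \<circ> e) ` X \<subseteq> f ` A" "d ` params S X \<psi> \<subseteq> D"
    using e \<psi>(1) by (auto simp: D_def)
  then show False
    using not_divides[OF _ _ \<psi>(2)] \<Psi>[OF \<psi>(1)]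
      ex_common_realization[OF smfA sm(3) smD indD, of \<psi> "f \<circ> e" X d] by blast
qed

end

section \<open>Terms\<close>

lemma finite_tm_vars: "finite (tm_vars t)"
  by (induction t) auto

lemma tm_val_cong: "(\<And>v. v \<in> tm_vars t \<Longrightarrow> s v = s' v) \<Longrightarrow> tm_val M s t = tm_val M s' t"
proof (induction t)
  case (App f ts)
  then have "map (tm_val M s) ts = map (tm_val M s') ts"
    by auto
  then show ?case
    by (simp only: tm_val.simps)
qed simp

lemma map_tm_val_cong:
  "(\<And>t v. t \<in> set ts \<Longrightarrow> v \<in> tm_vars t \<Longrightarrow> s v = s' v) \<Longrightarrow> map (tm_val M s) ts = map (tm_val M s') ts"
  by (auto intro: tm_val_cong)

lemma tm_val_closed:
  assumes "closed_structure L M"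
  shows "\<lbrakk>wf_tm L t; s ` tm_vars t \<subseteq> universe M\<rbrakk> \<Longrightarrow> tm_val M s t \<in> universe M"
proof (induction t)
  case (App f ts)
  have "tm_val M s t \<in> universe M" if "t \<in> set ts" for t
    using App that by (fastforce simp: list_all_iff)
  then have "map (tm_val M s) ts \<in> tuples (universe M) (fun_arity L f)"
    using App.prems by (auto simp: tuples_def)
  then show ?case
    using assms App.prems by (simp add: closed_structure_def)
qed simp

lemma tm_vals_tuples:
  assumes "closed_structure L M" "\<And>t. t \<in> set ts \<Longrightarrow> wf_tm L t"
    "\<And>t. t \<in> set ts \<Longrightarrow> s ` tm_vars t \<subseteq> universe M"
  shows "map (tm_val M s) ts \<in> tuples (universe M) (length ts)"
  using tm_val_closed[OF assms(1)] assms(2,3) by (auto simp: tuples_def)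

lemma tm_val_aut:
  assumes M: "closed_structure L M" and g: "automorphism L M g"
  shows "\<lbrakk>wf_tm L t; s ` tm_vars t \<subseteq> universe M\<rbrakk> \<Longrightarrow> tm_val M (g \<circ> s) t = g (tm_val M s t)"
proof (induction t)
  case (App f ts)
  have wf: "wf_tm L t" and vars: "s ` tm_vars t \<subseteq> universe M" if "t \<in> set ts" for t
    using App.prems that by (auto simp: list_all_iff)
  have "tm_val M (g \<circ> s) t = g (tm_val M s t)" if "t \<in> set ts" for t
    using App.IH[OF that wf vars] that by blast
  then have "map (tm_val M (g \<circ> s)) ts = map g (map (tm_val M s) ts)"
    by simp
  moreover have "map (tm_val M s) ts \<in> tuples (universe M) (length ts)"
    using tm_vals_tuples[OF M, of ts s] wf vars by blast
  ultimately show ?case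
    using g App.prems
    by (simp add: automorphism_def comp_def del: map_map)
qed simp

lemma map_tm_val_aut:
  assumes "closed_structure L M" "automorphism L M g" "\<And>t. t \<in> set ts \<Longrightarrow> wf_tm L t"
    "\<And>t. t \<in> set ts \<Longrightarrow> s ` tm_vars t \<subseteq> universe M"
  shows "map (tm_val M (g \<circ> s)) ts = map g (map (tm_val M s) ts)"
proof -
  have "tm_val M (g \<circ> s) t = g (tm_val M s t)" if "t \<in> set ts" for t
    using tm_val_aut[OF assms(1,2)] assms(3,4) that by blast
  then show ?thesis by simp
qed

lemma automorphism_image: "automorphism L M g \<Longrightarrow> g ` universe M = universe M"
  by (simp add: automorphism_def bij_betw_def)

section \<open>Discrete logic\<close>

lemma finite_fm_vars: "finite (fm_vars \<phi>)"
  by (induction \<phi>) (auto simp: finite_tm_vars)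

lemma sat_cong: "(\<And>v. v \<in> fm_vars \<phi> \<Longrightarrow> s v = s' v) \<Longrightarrow> sat M \<phi> s = sat M \<phi> s'"
proof (induction \<phi> arbitrary: s s')
  case (Eq t u)
  then show ?case
    using tm_val_cong[of t s s' M] tm_val_cong[of u s s' M] by simp
next
  case (Rel r ts)
  then have "map (tm_val M s) ts = map (tm_val M s') ts"
    by (intro map_tm_val_cong) auto
  then show ?case
    by (simp only: sat.simps)
next
  case (Neg \<phi>)
  have "sat M \<phi> s = sat M \<phi> s'"
    using Neg.prems by (intro Neg.IH) auto
  then show ?case by simp
next
  case (Conj \<phi> \<psi>)
  have "sat M \<phi> s = sat M \<phi> s'" "sat M \<psi> s = sat M \<psi> s'"
    using Conj.prems by (auto intro!: Conj.IH)
  then show ?case by simp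
next
  case (Exi v \<phi>)
  have "sat M \<phi> (s(v := x)) = sat M \<phi> (s'(v := x))" for x
    using Exi.prems by (intro Exi.IH) auto
  then show ?case by simp
qed

text \<open>Induction on the formula. Injectivity of \<open>g\<close> handles equations, and
  surjectivity handles quantifiers: a witness \<open>x\<close> for \<open>s\<close> corresponds to
  \<open>g x\<close> for \<open>g \<circ> s\<close>.\<close>

lemma sat_aut:
  assumes M: "closed_structure L M" and g: "automorphism L M g"
  shows "\<lbrakk>wf_fm L \<phi>; s ` fm_vars \<phi> \<subseteq> universe M\<rbrakk> \<Longrightarrow> sat M \<phi> (g \<circ> s) = sat M \<phi> s"
proof (induction \<phi> arbitrary: s)
  case (Eq t u)
  then have "tm_val M s t \<in> universe M" "tm_val M s u \<in> universe M"
    by (auto intro!: tm_val_closed[OF M])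
  moreover have "inj_on g (universe M)"
    using g by (simp add: automorphism_def bij_betw_def)
  moreover have "tm_val M (g \<circ> s) t = g (tm_val M s t)" "tm_val M (g \<circ> s) u = g (tm_val M s u)"
    using Eq by (auto intro!: tm_val_aut[OF M g])
  ultimately show ?case
    by (simp add: inj_on_eq_iff comp_def)
next
  case (Rel r ts)
  have wf: "wf_tm L t" and vars: "s ` tm_vars t \<subseteq> universe M" if "t \<in> set ts" for t
    using Rel.prems that by (auto simp: list_all_iff)
  have "map (tm_val M s) ts \<in> tuples (universe M) (length ts)"
    using tm_vals_tuples[OF M, of ts s] wf vars by blast
  then have "rel_of M r (map g (map (tm_val M s) ts)) = rel_of M r (map (tm_val M s) ts)"
    using g Rel.prems by (simp add: automorphism_def del: map_map)
  then show ?case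
    using map_tm_val_aut[OF M g, of ts s] wf vars by (simp add: comp_def del: map_map)
next
  case (Exi v \<phi>)
  have "sat M \<phi> ((g \<circ> s)(v := g x)) = sat M \<phi> (s(v := x))" if "x \<in> universe M" for x
  proof -
    have "s(v := x) ` fm_vars \<phi> \<subseteq> universe M"
      using Exi.prems that by auto
    moreover have "(g \<circ> s)(v := g x) = g \<circ> s(v := x)"
      by auto
    ultimately show ?thesis
      using Exi.IH[of "s(v := x)"] Exi.prems by (simp only: wf_fm.simps)
  qed
  then have "(\<exists>x \<in> g ` universe M. sat M \<phi> ((g \<circ> s)(v := x))) = (\<exists>x \<in> universe M. sat M \<phi> (s(v := x)))"
    by auto
  then show ?case
    using automorphism_image[OF g] by (simp add: comp_def)
qed (auto simp: image_Un)

lemma fo_homogeneous_semantics: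
  assumes "fo_monster L T \<kappa> M"
  shows "homogeneous_semantics (fo_sem L M) (automorphism L M) \<kappa>"
proof
  have M: "closed_structure L M"
    using assms by (simp add: fo_monster_def fo_models_def)
  show "\<exists>\<phi> \<in> formulas (fo_sem L M). free_vars (fo_sem L M) \<phi> = {0, 1} \<and>
     (\<forall>s. s 0 \<in> points (fo_sem L M) \<and> s 1 \<in> points (fo_sem L M) \<longrightarrow>
       (truth (fo_sem L M) \<phi> s = designated (fo_sem L M) \<longleftrightarrow> s 0 = s 1))"
    by (rule bexI[of _ "Eq (Var 0) (Var 1)"]) (auto simp: fo_sem_def)
  show "g x \<in> points (fo_sem L M)" if "automorphism L M g" "x \<in> points (fo_sem L M)" for g x
    using automorphism_image[OF that(1)] that(2) by (auto simp: fo_sem_def)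
  show "truth (fo_sem L M) \<phi> s = truth (fo_sem L M) \<phi> s'"
    if "\<And>v. v \<in> free_vars (fo_sem L M) \<phi> \<Longrightarrow> s v = s' v" for \<phi> s s'
    using sat_cong[of \<phi> s s' M] that by (simp add: fo_sem_def)
  show "truth (fo_sem L M) \<phi> (g \<circ> s) = truth (fo_sem L M) \<phi> s"
    if "automorphism L M g" "\<phi> \<in> formulas (fo_sem L M)"
      "s ` free_vars (fo_sem L M) \<phi> \<subseteq> points (fo_sem L M)" for g \<phi> s
    using sat_aut[OF M that(1)] that(2,3) by (simp add: fo_sem_def)
qed (use assms in \<open>simp_all add: fo_sem_def fo_monster_def finite_fm_vars\<close>)

lemma fo_nonforkingI:
  assumes "fo_monster L T \<kappa> M" "stationary_independence (fo_sem L M) \<kappa> ind"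
    "small (fo_sem L M) \<kappa> A" "small (fo_sem L M) \<kappa> B" "small (fo_sem L M) \<kappa> C" "ind A C B"
  shows "fo_nonforking L M A C B"
proof -
  interpret homogeneous_independence "fo_sem L M" "automorphism L M" \<kappa> ind
    by (rule homogeneous_independence.intro[OF fo_homogeneous_semantics[OF assms(1)] assms(2)])
  show ?thesis
    unfolding fo_nonforking_def
  proof (rule nonforkingI[OF assms(3-6), where divides = "fo_divides L M"])
    fix X \<psi> d a
    assume "fo_divides L M C X \<psi> d"
    then obtain ds :: "nat \<Rightarrow> nat \<Rightarrow> _" and k
      where ds: "\<forall>l. same_type (fo_sem L M) C (params (fo_sem L M) X \<psi>) (ds l) d"
      and k: "\<forall>K. finite K \<and> card K = k \<longrightarrow>
        \<not> (\<exists>a. a ` X \<subseteq> universe M \<and> (\<forall>l \<in> K. instance_val (fo_sem L M) X \<psi> a (ds l)))"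
      unfolding fo_divides_def by (elim exE conjE) (rule that)
    assume "instance_holds (fo_sem L M) X \<psi> a d"
      and "\<And>ds. \<forall>l :: nat. same_type (fo_sem L M) C (params (fo_sem L M) X \<psi>) (ds l) d \<Longrightarrow>
        \<exists>a'. a' ` X \<subseteq> points (fo_sem L M) \<and>
          (\<forall>l. instance_val (fo_sem L M) X \<psi> a' (ds l) = instance_val (fo_sem L M) X \<psi> a d)"
    from this(2)[OF ds] obtain a' where a': "a' ` X \<subseteq> points (fo_sem L M)"
      "\<And>l. instance_val (fo_sem L M) X \<psi> a' (ds l) = instance_val (fo_sem L M) X \<psi> a d"
      by auto
    have "instance_val (fo_sem L M) X \<psi> a' (ds l)" for l
      using \<open>instance_holds (fo_sem L M) X \<psi> a d\<close> a'(2)[of l]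
      by (simp add: instance_holds_def fo_sem_def)
    moreover have "a' ` X \<subseteq> universe M"
      using a'(1) by (simp add: fo_sem_def)
    \<comment> \<open>The index set \<open>{..<k}\<close> has exactly \<open>k\<close> elements, and
      \<open>a'\<close> satisfies all of its instances.\<close>
    ultimately show False
      using k[rule_format, of "{..<k}", OF conjI[OF finite_lessThan card_lessThan]] by blast
  next
    fix X \<phi> b
    assume "fo_forks L M C X \<phi> b"
    then show "\<exists>\<Psi>. finite \<Psi> \<and>
        (\<forall>(\<psi>, d) \<in> \<Psi>. \<psi> \<in> formulas (fo_sem L M) \<and>
           d ` params (fo_sem L M) X \<psi> \<subseteq> points (fo_sem L M) \<and> fo_divides L M C X \<psi> d) \<and>
        (\<forall>a. a ` X \<subseteq> points (fo_sem L M) \<and> instance_holds (fo_sem L M) X \<phi> a b \<longrightarrow>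
           (\<exists>(\<psi>, d) \<in> \<Psi>. instance_holds (fo_sem L M) X \<psi> a d))"
      by (auto simp: fo_forks_def instance_holds_def fo_sem_def)
  qed
qed

section \<open>Continuous logic\<close>

lemma finite_cfm_vars: "finite (cfm_vars \<phi>)"
  by (induction \<phi>) (auto simp: finite_tm_vars)

lemma cval_cong: "(\<And>v. v \<in> cfm_vars \<phi> \<Longrightarrow> s v = s' v) \<Longrightarrow> cval M \<phi> s = cval M \<phi> s'"
proof (induction \<phi> arbitrary: s s')
  case (Dst t u)
  then show ?case
    using tm_val_cong[of t s s' M] tm_val_cong[of u s s' M] by simp
next
  case (Prd r ts)
  then have "map (tm_val M s) ts = map (tm_val M s') ts"
    by (intro map_tm_val_cong) auto
  then show ?case
    by (simp only: cval.simps)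
next
  case (Con u \<phi>s)
  have "map (\<lambda>\<phi>. cval M \<phi> s) \<phi>s = map (\<lambda>\<phi>. cval M \<phi> s') \<phi>s"
    using Con.prems by (intro map_cong refl Con.IH) auto
  then show ?case
    by (simp only: cval.simps map_map comp_def)
next
  case (SupQ v \<phi>)
  have "cval M \<phi> (s(v := x)) = cval M \<phi> (s'(v := x))" for x
    using SupQ.prems by (intro SupQ.IH) auto
  then show ?case by simp
next
  case (InfQ v \<phi>)
  have "cval M \<phi> (s(v := x)) = cval M \<phi> (s'(v := x))" for x
    using InfQ.prems by (intro InfQ.IH) auto
  then show ?case by simp
qed

lemma cval_aut:
  assumes M: "closed_structure L M" and cg: "cautomorphism L M g"
  shows "\<lbrakk>wf_cfm L \<phi>; s ` cfm_vars \<phi> \<subseteq> universe M\<rbrakk> \<Longrightarrow> cval M \<phi> (g \<circ> s) = cval M \<phi> s"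
proof (induction \<phi> arbitrary: s)
  have g: "automorphism L M g"
    using cg by (simp add: cautomorphism_def)
  \<comment> \<open>Supremum and infimum depend only on the set of values as \<open>x\<close> ranges
    over the universe, and \<open>g\<close> permutes the universe; one fact thus covers both
    quantifiers.\<close>
  have upd: "(\<lambda>x. cval M \<phi> ((g \<circ> s)(v := x))) ` universe M = (\<lambda>x. cval M \<phi> (s(v := x))) ` universe M"
    if "wf_cfm L \<phi>" "s ` (cfm_vars \<phi> - {v}) \<subseteq> universe M"
      and IH: "\<And>s. wf_cfm L \<phi> \<Longrightarrow> s ` cfm_vars \<phi> \<subseteq> universe M \<Longrightarrow> cval M \<phi> (g \<circ> s) = cval M \<phi> s"
    for \<phi> s v
  proof -
    have "cval M \<phi> ((g \<circ> s)(v := g x)) = cval M \<phi> (s(v := x))" if "x \<in> universe M" for x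
    proof -
      have "s(v := x) ` cfm_vars \<phi> \<subseteq> universe M"
        using \<open>s ` (cfm_vars \<phi> - {v}) \<subseteq> universe M\<close> that by auto
      moreover have "(g \<circ> s)(v := g x) = g \<circ> s(v := x)"
        by auto
      ultimately show ?thesis
        using IH[of "s(v := x)"] \<open>wf_cfm L \<phi>\<close> by simp
    qed
    then have "(\<lambda>x. cval M \<phi> ((g \<circ> s)(v := x))) ` g ` universe M = (\<lambda>x. cval M \<phi> (s(v := x))) ` universe M"
      by (simp add: image_image)
    then show ?thesis
      using automorphism_image[OF g] by (simp add: comp_def)
  qed
  {
    case (Dst t u)
    then have "tm_val M s t \<in> universe M" "tm_val M s u \<in> universe M"
      by (auto intro!: tm_val_closed[OF M])
    moreover have "tm_val M (g \<circ> s) t = g (tm_val M s t)" "tm_val M (g \<circ> s) u = g (tm_val M s u)"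
      using Dst by (auto intro!: tm_val_aut[OF M g])
    ultimately show ?case
      using cg by (simp add: cautomorphism_def comp_def)
  next
    case (Prd r ts)
    have wf: "wf_tm L t" and vars: "s ` tm_vars t \<subseteq> universe M" if "t \<in> set ts" for t
      using Prd.prems that by (auto simp: list_all_iff)
    have "map (tm_val M s) ts \<in> tuples (universe M) (length ts)"
      using tm_vals_tuples[OF M, of ts s] wf vars by blast
    then have "rel_of M r (map g (map (tm_val M s) ts)) = rel_of M r (map (tm_val M s) ts)"
      using g Prd.prems by (simp add: automorphism_def del: map_map)
    then show ?case
      using map_tm_val_aut[OF M g, of ts s] wf vars by (simp add: comp_def del: map_map)
  next
    case (Con u \<phi>s)
    have "cval M \<phi> (g \<circ> s) = cval M \<phi> s" if "\<phi> \<in> set \<phi>s" for \<phi>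
      using Con.prems that by (intro Con.IH) (auto simp: list_all_iff)
    then have "map (\<lambda>\<phi>. cval M \<phi> (g \<circ> s)) \<phi>s = map (\<lambda>\<phi>. cval M \<phi> s) \<phi>s"
      by simp
    then show ?case
      by (simp only: cval.simps map_map comp_def)
  next
    case (SupQ v \<phi>)
    from SupQ.prems have prems: "wf_cfm L \<phi>" "s ` (cfm_vars \<phi> - {v}) \<subseteq> universe M"
      by simp_all
    show ?case
      by (simp only: cval.simps upd[OF prems SupQ.IH])
  next
    case (InfQ v \<phi>)
    from InfQ.prems have prems: "wf_cfm L \<phi>" "s ` (cfm_vars \<phi> - {v}) \<subseteq> universe M"
      by simp_all
    show ?case
      by (simp only: cval.simps upd[OF prems InfQ.IH])
  }
qed

lemma cont_homogeneous_semantics: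
  assumes "cont_monster L T \<kappa> M"
  shows "homogeneous_semantics (cont_sem L M) (cautomorphism L M) \<kappa>"
proof
  have M: "closed_structure L M" and metric: "Metric_space (universe M) (mdistance M)"
    using assms by (simp_all add: cont_monster_def cont_models_def metric_structure_def)
  show "\<exists>\<phi> \<in> formulas (cont_sem L M). free_vars (cont_sem L M) \<phi> = {0, 1} \<and>
     (\<forall>s. s 0 \<in> points (cont_sem L M) \<and> s 1 \<in> points (cont_sem L M) \<longrightarrow>
       (truth (cont_sem L M) \<phi> s = designated (cont_sem L M) \<longleftrightarrow> s 0 = s 1))"
    \<comment> \<open>The distance of two points is 0 exactly when they coincide.\<close>
    by (rule bexI[of _ "Dst (Var 0) (Var 1)"])
      (auto simp: cont_sem_def Metric_space.zero[OF metric])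
  show "g x \<in> points (cont_sem L M)" if "cautomorphism L M g" "x \<in> points (cont_sem L M)" for g x
    using automorphism_image[of L M g] that by (auto simp: cont_sem_def cautomorphism_def)
  show "truth (cont_sem L M) \<phi> s = truth (cont_sem L M) \<phi> s'"
    if "\<And>v. v \<in> free_vars (cont_sem L M) \<phi> \<Longrightarrow> s v = s' v" for \<phi> s s'
    using cval_cong[of \<phi> s s' M] that by (simp add: cont_sem_def)
  show "truth (cont_sem L M) \<phi> (g \<circ> s) = truth (cont_sem L M) \<phi> s"
    if "cautomorphism L M g" "\<phi> \<in> formulas (cont_sem L M)"
      "s ` free_vars (cont_sem L M) \<phi> \<subseteq> points (cont_sem L M)" for g \<phi> s
    using cval_aut[OF M that(1)] that(2,3) by (simp add: cont_sem_def)
qed (use assms in \<open>simp_all add: cont_sem_def cont_monster_def finite_cfm_vars\<close>)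

lemma cont_nonforkingI:
  assumes "cont_monster L T \<kappa> M" "stationary_independence (cont_sem L M) \<kappa> ind"
    "small (cont_sem L M) \<kappa> A" "small (cont_sem L M) \<kappa> B" "small (cont_sem L M) \<kappa> C" "ind A C B"
  shows "cont_nonforking L M A C B"
proof -
  interpret homogeneous_independence "cont_sem L M" "cautomorphism L M" \<kappa> ind
    by (rule homogeneous_independence.intro[OF cont_homogeneous_semantics[OF assms(1)] assms(2)])
  show ?thesis
    unfolding cont_nonforking_def
  proof (rule nonforkingI[OF assms(3-6), where divides = "cont_divides L M"])
    fix X \<psi> d a
    assume "cont_divides L M C X \<psi> d"
    then obtain ds :: "nat \<Rightarrow> nat \<Rightarrow> _" and \<epsilon> k where "\<epsilon> > 0"
      and ds: "\<forall>l. same_type (cont_sem L M) C (params (cont_sem L M) X \<psi>) (ds l) d"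
      and k: "\<forall>K. finite K \<and> card K = k \<longrightarrow>
        \<not> (\<exists>a. a ` X \<subseteq> universe M \<and> (\<forall>l \<in> K. instance_val (cont_sem L M) X \<psi> a (ds l) \<le> \<epsilon>))"
      unfolding cont_divides_def by (elim exE conjE) (rule that)
    assume "instance_holds (cont_sem L M) X \<psi> a d"
      and "\<And>ds. \<forall>l :: nat. same_type (cont_sem L M) C (params (cont_sem L M) X \<psi>) (ds l) d \<Longrightarrow>
        \<exists>a'. a' ` X \<subseteq> points (cont_sem L M) \<and>
          (\<forall>l. instance_val (cont_sem L M) X \<psi> a' (ds l) = instance_val (cont_sem L M) X \<psi> a d)"
    from this(2)[OF ds] obtain a' where a': "a' ` X \<subseteq> points (cont_sem L M)"
      "\<And>l. instance_val (cont_sem L M) X \<psi> a' (ds l) = instance_val (cont_sem L M) X \<psi> a d"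
      by auto
    \<comment> \<open>The value at \<open>d\<close> is exactly 0 and is copied to every
      \<open>ds l\<close>, so it stays below any positive \<open>\<epsilon>\<close>.\<close>
    have "instance_val (cont_sem L M) X \<psi> a' (ds l) \<le> \<epsilon>" for l
      using \<open>instance_holds (cont_sem L M) X \<psi> a d\<close> a'(2)[of l] \<open>\<epsilon> > 0\<close>
      by (simp add: instance_holds_def cont_sem_def)
    moreover have "a' ` X \<subseteq> universe M"
      using a'(1) by (simp add: cont_sem_def)
    ultimately show False
      using k[rule_format, of "{..<k}", OF conjI[OF finite_lessThan card_lessThan]] by blast
  next
    fix X \<phi> b
    assume "cont_forks L M C X \<phi> b"
    then obtain \<Psi> where fin: "finite \<Psi>" "\<Psi> \<noteq> {}"
      and \<Psi>: "\<forall>(\<psi>, d) \<in> \<Psi>. wf_cfm L \<psi> \<and> d ` params (cont_sem L M) X \<psi> \<subseteq> universe M \<and>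
        cont_divides L M C X \<psi> d"
      and Min: "\<forall>a. a ` X \<subseteq> universe M \<and> instance_val (cont_sem L M) X \<phi> a b = 0 \<longrightarrow>
        Min ((\<lambda>(\<psi>, d). instance_val (cont_sem L M) X \<psi> a d) ` \<Psi>) = 0"
      unfolding cont_forks_def by (elim exE conjE) (rule that)
    \<comment> \<open>A minimum over a finite nonempty set is attained, so a vanishing minimum
      yields a single formula with value 0.\<close>
    have "\<exists>(\<psi>, d) \<in> \<Psi>. instance_val (cont_sem L M) X \<psi> a d = 0"
      if "a ` X \<subseteq> universe M" "instance_val (cont_sem L M) X \<phi> a b = 0" for a
    proof -
      have "0 \<in> (\<lambda>(\<psi>, d). instance_val (cont_sem L M) X \<psi> a d) ` \<Psi>"
        using Min_in[of "(\<lambda>(\<psi>, d). instance_val (cont_sem L M) X \<psi> a d) ` \<Psi>"] Min that fin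
        by simp
      then show ?thesis by force
    qed
    with fin \<Psi> show "\<exists>\<Psi>. finite \<Psi> \<and>
        (\<forall>(\<psi>, d) \<in> \<Psi>. \<psi> \<in> formulas (cont_sem L M) \<and>
           d ` params (cont_sem L M) X \<psi> \<subseteq> points (cont_sem L M) \<and> cont_divides L M C X \<psi> d) \<and>
        (\<forall>a. a ` X \<subseteq> points (cont_sem L M) \<and> instance_holds (cont_sem L M) X \<phi> a b \<longrightarrow>
           (\<exists>(\<psi>, d) \<in> \<Psi>. instance_holds (cont_sem L M) X \<psi> a d))"
      by (intro exI[of _ \<Psi>]) (simp add: instance_holds_def cont_sem_def)
  qed
qed

theorem theorem4p1:
  shows
    "(\<forall>(L :: ('f, 'r) lang) T (\<kappa> :: 'k rel) (M :: ('f, 'r, 'm, bool) struct) ind.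
        fo_complete L T \<and> fo_monster L T \<kappa> M \<and>
        stationary_independence (fo_sem L M) \<kappa> ind \<longrightarrow>
        (\<forall>A B C. small (fo_sem L M) \<kappa> A \<and> small (fo_sem L M) \<kappa> B \<and> small (fo_sem L M) \<kappa> C \<and>
           ind A C B \<longrightarrow> fo_nonforking L M A C B \<and> fo_nonforking L M B C A))
   \<and> (\<forall>(L :: ('g, 's) clang) T (\<kappa> :: 'j rel) (M :: ('g, 's, 'n) mstruct) ind.
        clanguage L \<and> cont_complete L T \<and> cont_monster L T \<kappa> M \<and>
        stationary_independence (cont_sem L M) \<kappa> ind \<longrightarrow>
        (\<forall>A B C. small (cont_sem L M) \<kappa> A \<and> small (cont_sem L M) \<kappa> B \<and> small (cont_sem L M) \<kappa> C \<and>
           ind A C B \<longrightarrow> cont_nonforking L M A C B \<and> cont_nonforking L M B C A))"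
proof (intro conjI[where P = "All _"] allI impI)
  fix L :: "('f, 'r) lang" and T and \<kappa> :: "'k rel" and M :: "('f, 'r, 'm, bool) struct" and ind A B C
  assume T: "fo_complete L T \<and> fo_monster L T \<kappa> M \<and> stationary_independence (fo_sem L M) \<kappa> ind"
    and sm: "small (fo_sem L M) \<kappa> A \<and> small (fo_sem L M) \<kappa> B \<and> small (fo_sem L M) \<kappa> C \<and> ind A C B"
  \<comment> \<open>Symmetry of \<open>ind\<close> reduces the second nonforking claim to the first
    with \<open>A\<close> and \<open>B\<close> exchanged.\<close>
  then have "ind B C A"
    using stationary_independence.symmetry by blast
  with T sm show "fo_nonforking L M A C B \<and> fo_nonforking L M B C A"
    using fo_nonforkingI by blast
next
  fix L :: "('g, 's) clang" and T and \<kappa> :: "'j rel" and M :: "('g, 's, 'n) mstruct" and ind A B C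
  assume T: "clanguage L \<and> cont_complete L T \<and> cont_monster L T \<kappa> M \<and>
      stationary_independence (cont_sem L M) \<kappa> ind"
    and sm: "small (cont_sem L M) \<kappa> A \<and> small (cont_sem L M) \<kappa> B \<and> small (cont_sem L M) \<kappa> C \<and> ind A C B"
  then have "ind B C A"
    using stationary_independence.symmetry by blast
  with T sm show "cont_nonforking L M A C B \<and> cont_nonforking L M B C A"
    using cont_nonforkingI by blast
qed

end
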